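(* Let $r\ge 1$ be an integer. A set $A\subseteq\mathbb{F}_2^r\setminus\{0\}$ with $|A|>\frac13\,2^r+2$ is a minimal $1$-saturating set if and only if there are a maximal sum-free set $S\subseteq\mathbb{F}_2^r$ and an element $s\in S\cup\{0\}$ such that $A=\big(s+(S\cup\{0\})\big)\setminus\{0\}$.
   Context: $\mathbb{F}_2^r$ denotes the elementary abelian $2$-group of rank $r$. For $X\subseteq\mathbb{F}_2^r$, $2X:=\{x_1+x_2\colon x_1,x_2\in X\}$ (with $x_1=x_2$ allowed), and $g+X:=\{g+x\colon x\in X\}$. A set $A\subseteq\mathbb{F}_2^r\setminus\{0\}$ is $1$-saturating if $A\cup 2A=\mathbb{F}_2^r$; it is minimal $1$-saturating if it is $1$-saturating and no proper subset of it is $1$-saturating. A set $S$ is sum-free if $S\cap 2S=\varnothing$, and maximal sum-free if it is sum-free and not properly contained in another sum-free subset of $\mathbb{F}_2^r$. *)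

theory Defs
  imports
    "HOL-Analysis.Finite_Cartesian_Product"
    "HOL-Library.Z2"
    "HOL-Library.Set_Algebras"
begin

text \<open>
  The group \<open>F_2^r\<close> is the type \<open>bit ^ 'n\<close> for an arbitrary finite index type \<open>'n\<close>,
  with \<open>r = CARD('n) \<ge> 1\<close>. The set \<open>2X\<close> is the sumset \<open>X + X\<close>, and the translate
  \<open>g + X\<close> is \<open>g +o X\<close>, both from \<open>Set_Algebras\<close>.
\<close>

instance bit :: finite
proof
  have "(UNIV :: bit set) \<subseteq> {0, 1}"
    using bit_not_zero_iff by blast
  then show "finite (UNIV :: bit set)"
    by (rule finite_subset) simp
qed

definition one_saturating :: "(bit ^ 'n) set \<Rightarrow> bool" where
  "one_saturating A \<longleftrightarrow> A \<subseteq> UNIV - {0} \<and> A \<union> (A + A) = UNIV"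

definition minimal_one_saturating :: "(bit ^ 'n) set \<Rightarrow> bool" where
  "minimal_one_saturating A \<longleftrightarrow> one_saturating A \<and> (\<forall>B. B \<subset> A \<longrightarrow> \<not> one_saturating B)"

definition sum_free :: "(bit ^ 'n) set \<Rightarrow> bool" where
  "sum_free S \<longleftrightarrow> S \<inter> (S + S) = {}"

definition maximal_sum_free :: "(bit ^ 'n) set \<Rightarrow> bool" where
  "maximal_sum_free S \<longleftrightarrow> sum_free S \<and> (\<forall>T. S \<subset> T \<longrightarrow> \<not> sum_free T)"

end

theory Submission
  imports Defs
begin

text \<open>
  Let \<open>X = A \<union> {0}\<close>, and join two elements of \<open>X\<close> by an edge if their sum has no other representation
  in \<open>X + X\<close>; let \<open>D\<close> be the set of these sums. Minimality of \<open>A\<close> says that every nonzero vertex lies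
  on an edge, and \<open>A\<close> comes from a maximal sum-free set exactly when some vertex \<open>s\<close> is joined to all
  the others. Comparing translates of \<open>X\<close> shows that no sum of three or five elements of \<open>D\<close> vanishes; since
  \<open>|D| \<ge> (|X| - 1) / 2 > 2\<^sup>r / 8\<close>, a packing argument excludes all longer odd relations as well, so \<open>D\<close> lies
  in the complement of a hyperplane. For an edge \<open>{a, b}\<close>, the sets \<open>a + X\<close> and \<open>b + X\<close> together cover
  \<open>|X| - 1\<close> points of that complement, so fewer than \<open>|X| / 2 - 3\<close> edges avoid both \<open>a\<close> and \<open>b\<close>. A graph in
  which this holds for every edge is a star.
\<close>

section \<open>Arithmetic and translates in F_2^r\<close>

lemma bit_vec_add_self [simp]: "x + x = (0 :: bit ^ 'n)"
  by (simp add: vec_eq_iff)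

lemma bit_vec_add_left_cancel [simp]: "x + (x + y) = (y :: bit ^ 'n)"
  by (simp flip: add.assoc)

lemma bit_vec_add_eq_0_iff [simp]: "x + y = 0 \<longleftrightarrow> x = (y :: bit ^ 'n)"
  by (metis add.right_neutral bit_vec_add_left_cancel bit_vec_add_self)

lemma mem_translate_iff: "x \<in> (+) g ` X \<longleftrightarrow> g + x \<in> X" for g :: "bit ^ 'n"
  by (metis bit_vec_add_left_cancel image_iff)

lemma card_translate [simp]: "card ((+) g ` X) = card X" for g :: "bit ^ 'n"
  by (simp add: card_image)

lemma card_bit_vec: "CARD(bit ^ 'n) = 2 ^ CARD('n)"
proof -
  have "(UNIV :: bit set) = {0, 1}"
    using bit_not_zero_iff by blast
  then have "CARD(bit) = 2"
    by (metis card_2_iff zero_neq_one)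
  then show ?thesis
    by simp
qed

lemma card_le_bit_vec: "card (Y :: (bit ^ 'n) set) \<le> CARD(bit ^ 'n)"
  by (rule card_mono) auto


section \<open>Unique sums\<close>

definition ends :: "(bit ^ 'n) set \<Rightarrow> bit ^ 'n \<Rightarrow> (bit ^ 'n) set" where
  "ends X d = {x \<in> X. d + x \<in> X}"

text \<open>For nonzero d the elements x and d + x differ, so the value 2 stands for one unordered
  representation: d labels an edge whose vertex set is \<open>ends X d\<close>.\<close>

definition unique_sums :: "(bit ^ 'n) set \<Rightarrow> (bit ^ 'n) set" where
  "unique_sums X = {d. d \<noteq> 0 \<and> card (ends X d) = 2}"

lemma unique_sumsD: "d \<in> unique_sums X \<Longrightarrow> d \<noteq> 0" "d \<in> unique_sums X \<Longrightarrow> card (ends X d) = 2"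
  by (simp_all add: unique_sums_def)

text \<open>This turns representations into packing: if g + h is a unique sum, then g + X and h + X
  share only 2 points.\<close>

lemma card_translate_inter:
  fixes X :: "(bit ^ 'n) set"
  shows "card ((+) g ` X \<inter> (+) h ` X) = card (ends X (g + h))"
proof -
  have "(+) g ` X \<inter> (+) h ` X = (+) g ` ends X (g + h)"
  proof (rule set_eqI)
    fix x
    have "g + h + (g + x) = h + x"
      by (simp add: ac_simps)
    then show "x \<in> (+) g ` X \<inter> (+) h ` X \<longleftrightarrow> x \<in> (+) g ` ends X (g + h)"
      by (simp add: mem_translate_iff ends_def)
  qed
  then show ?thesis by simp
qed

lemma card_inter_translate:
  fixes X :: "(bit ^ 'n) set"
  shows "card (X \<inter> (+) h ` X) = card (ends X h)"
  using card_translate_inter[of 0 X h] by simp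

lemma ends_unique_sum:
  fixes X :: "(bit ^ 'n) set"
  assumes "d \<in> unique_sums X" "a \<in> ends X d"
  shows "ends X d = {a, d + a}"
proof -
  have "{a, d + a} \<subseteq> ends X d"
    using assms(2) by (auto simp: ends_def)
  moreover have "card {a, d + a} = card (ends X d)"
    using unique_sumsD[OF assms(1)] by auto
  ultimately show ?thesis
    by (metis card_subset_eq finite)
qed

lemma unique_sum_representation:
  fixes X :: "(bit ^ 'n) set"
  assumes "d \<in> unique_sums X" "x \<in> X" "y \<in> X" "x + y = d" "u \<in> X" "v \<in> X" "u + v = d"
  shows "{u, v} = {x, y}"
proof -
  have "d + x = y" "d + u = v"
    by (simp_all add: ac_simps flip: assms(4)) (simp add: ac_simps assms(4) flip: assms(7))
  then have "x \<in> ends X d" "u \<in> ends X d"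
    using assms by (simp_all add: ends_def)
  then have "{x, d + x} = {u, d + u}"
    using ends_unique_sum[OF assms(1)] by metis
  then show ?thesis
    using \<open>d + x = y\<close> \<open>d + u = v\<close> by simp
qed

lemma unique_sumsI:
  fixes X :: "(bit ^ 'n) set"
  assumes "x \<in> X" "y \<in> X" "x \<noteq> y"
    and "\<And>u v. u \<in> X \<Longrightarrow> v \<in> X \<Longrightarrow> u + v = x + y \<Longrightarrow> u \<in> {x, y}"
  shows "x + y \<in> unique_sums X"
proof -
  have "ends X (x + y) = {x, y}"
  proof
    show "ends X (x + y) \<subseteq> {x, y}"
      using assms(4)[of _ "x + y + _"] by (auto simp: ends_def ac_simps)
    show "{x, y} \<subseteq> ends X (x + y)"
      using assms by (auto simp: ends_def ac_simps)
  qed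
  then show ?thesis
    using assms(3) by (simp add: unique_sums_def)
qed

lemma inj_on_ends: "inj_on (ends X) (unique_sums X)"
proof (rule inj_onI)
  fix d d'
  assume d: "d \<in> unique_sums X" "d' \<in> unique_sums X" and eq: "ends X d = ends X d'"
  obtain a where a: "a \<in> ends X d"
    using unique_sumsD(2)[OF d(1)] by fastforce
  then have "{a, d + a} = {a, d' + a}"
    using ends_unique_sum[OF d(1)] ends_unique_sum[OF d(2)] eq by auto
  then show "d = d'"
    using unique_sumsD(1)[OF d(1)] unique_sumsD(1)[OF d(2)] by (auto simp: doubleton_eq_iff)
qed

lemma card_Un_ge:
  assumes "finite S" "finite T"
  shows "card S + card T \<le> card (S \<union> T) + card (S \<inter> T)"
  using card_Un_Int[OF assms] by simp

lemma card_Un4_le: "card ((S \<union> T) \<union> (V \<union> W)) \<le> (card S + card T) + (card V + card W)"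
  by (rule order_trans[OF card_Un_le add_mono[OF card_Un_le card_Un_le]])

text \<open>Otherwise X, c + X and d + X would pairwise meet in 2 points, and their union would have
  at least 3|X| - 6 > 2^r elements.\<close>

lemma unique_sums_sum_free:
  fixes X :: "(bit ^ 'n) set"
  assumes large: "CARD(bit ^ 'n) + 10 \<le> 3 * card X"
    and "c \<in> unique_sums X" "d \<in> unique_sums X"
  shows "c + d \<notin> unique_sums X"
proof
  assume "c + d \<in> unique_sums X"
  then have c: "card (X \<inter> (+) c ` X) = 2" "card (X \<inter> (+) d ` X) = 2"
    "card ((+) c ` X \<inter> (+) d ` X) = 2"
    using assms by (simp_all add: card_inter_translate card_translate_inter unique_sums_def)
  have "card X + card X \<le> card (X \<union> (+) c ` X) + 2"
    using card_Un_ge[of X "(+) c ` X"] c by simp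
  moreover have "card (X \<union> (+) c ` X) + card X
      \<le> card (X \<union> (+) c ` X \<union> (+) d ` X) + card ((X \<union> (+) c ` X) \<inter> (+) d ` X)"
    using card_Un_ge[of "X \<union> (+) c ` X" "(+) d ` X"] by simp
  moreover have "card ((X \<union> (+) c ` X) \<inter> (+) d ` X) \<le> 4"
    using card_Un_le[of "X \<inter> (+) d ` X" "(+) c ` X \<inter> (+) d ` X"] c by (simp add: Int_Un_distrib2)
  moreover have "card (X \<union> (+) c ` X \<union> (+) d ` X) \<le> CARD(bit ^ 'n)"
    by (rule card_le_bit_vec)
  ultimately show False
    using large by linarith
qed

text \<open>
  Let \<open>h\<close> be the common value of the two sums and \<open>r\<close> the number of its ordered representations in
  \<open>X + X\<close>. The set \<open>X \<union> (h + X)\<close> is almost disjoint from its translate by \<open>d\<^sub>4\<close>, so \<open>r\<close> is large; and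
  the sets \<open>X\<close>, \<open>d\<^sub>1 + X\<close>, \<open>d\<^sub>2 + ends X h\<close>, \<open>d\<^sub>3 + ends X h\<close> are almost disjoint, so \<open>r\<close> is small.
\<close>

lemma unique_sums_no_five_relation:
  fixes X :: "(bit ^ 'n) set"
  assumes large: "CARD(bit ^ 'n) + 10 \<le> 3 * card X"
    and D: "d1 \<in> unique_sums X" "d2 \<in> unique_sums X" "d3 \<in> unique_sums X"
      "d4 \<in> unique_sums X" "d5 \<in> unique_sums X"
  shows "d1 + d2 + d3 \<noteq> d4 + d5"
proof
  assume rel: "d1 + d2 + d3 = d4 + d5"
  define h where "h = d4 + d5"
  define Y where "Y = ends X h"
  have h123: "h = d1 + d2 + d3"
    using rel by (simp add: h_def)
  have "h \<noteq> d1"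
    using unique_sums_sum_free[OF large D(4,5)] D(1) by (auto simp: h_def)
  have Y: "Y \<subseteq> X" "Y \<subseteq> (+) h ` X" "\<And>y. h + y \<in> Y \<longleftrightarrow> y \<in> Y"
    by (auto simp: Y_def ends_def mem_translate_iff)
  have small: "card (V \<inter> W) \<le> 2"
    if "V \<subseteq> (+) g ` X" "W \<subseteq> (+) g' ` X" "g + g' \<in> unique_sums X" for V W g g'
  proof -
    have "card (V \<inter> W) \<le> card ((+) g ` X \<inter> (+) g' ` X)"
      by (rule card_mono) (use that in auto)
    then show ?thesis
      using that(3) by (simp add: card_translate_inter unique_sums_def)
  qed
  let ?N = "CARD(bit ^ 'n)"

  define U where "U = X \<union> (+) h ` X"
  have "card X + card X = card U + card Y"
    using card_Un_Int[of X "(+) h ` X"] by (simp add: U_def Y_def card_inter_translate)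
  moreover have "card U + card U \<le> ?N + card (U \<inter> (+) d4 ` U)"
    using card_Un_ge[of U "(+) d4 ` U"] card_le_bit_vec[of "U \<union> (+) d4 ` U"] by simp
  \<comment> \<open>As d4 + h = d5, the translate of U consists of d4 + X and d5 + X. Each differs
    from X and from h + X by the shift d4 or d5, which gives four intersections of at most 2
    points.\<close>
  moreover have "card (U \<inter> (+) d4 ` U) \<le> 8"
  proof -
    have "(+) d4 ` U = (+) d4 ` X \<union> (+) d5 ` X"
    proof -
      have "(+) d4 ` (+) h ` X = (+) d5 ` X"
        by (simp add: image_image h_def add.assoc)
      then show ?thesis
        by (simp add: U_def image_Un)
    qed
    then have "U \<inter> (+) d4 ` U = ((X \<inter> (+) d4 ` X) \<union> (X \<inter> (+) d5 ` X))
        \<union> (((+) h ` X \<inter> (+) d4 ` X) \<union> ((+) h ` X \<inter> (+) d5 ` X))"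
      by (auto simp: U_def)
    then have "card (U \<inter> (+) d4 ` U) \<le> (card (X \<inter> (+) d4 ` X) + card (X \<inter> (+) d5 ` X))
        + (card ((+) h ` X \<inter> (+) d4 ` X) + card ((+) h ` X \<inter> (+) d5 ` X))"
      by (simp only: card_Un4_le)
    moreover have "card (X \<inter> (+) d4 ` X) \<le> 2" "card (X \<inter> (+) d5 ` X) \<le> 2"
      using D by (simp_all add: card_inter_translate unique_sums_def)
    moreover have "card ((+) h ` X \<inter> (+) d4 ` X) \<le> 2" "card ((+) h ` X \<inter> (+) d5 ` X) \<le> 2"
      using D by (auto intro!: small simp: h_def ac_simps)
    ultimately show ?thesis by linarith
  qed
  ultimately have lower: "4 * card X \<le> ?N + 8 + 2 * card Y"
    by linarith

  \<comment> \<open>Y lies in both X and h + X, so each translate of Y lies in two translates of X.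
    The first inclusion bounds its overlap with X, the second its overlap with d1 + X.\<close>
  have Y2: "(+) d2 ` Y \<subseteq> (+) d2 ` X" "(+) d2 ` Y \<subseteq> (+) (d1 + d3) ` X"
    and Y3: "(+) d3 ` Y \<subseteq> (+) d3 ` X" "(+) d3 ` Y \<subseteq> (+) (d1 + d2) ` X"
    using Y(1,2) by (auto simp: mem_translate_iff h123 subset_iff ac_simps)
  \<comment> \<open>Y is invariant under h. A common point puts y and d1 + y, hence also h + y and h
    + d1 + y, into Y; uniqueness of d1 then forces h = 0 or h = d1, and both are sum relations of
    length three.\<close>
  have disj: "(+) d2 ` Y \<inter> (+) d3 ` Y = {}"
  proof (rule ccontr)
    assume "(+) d2 ` Y \<inter> (+) d3 ` Y \<noteq> {}"
    then obtain y y' where "y \<in> Y" "y' \<in> Y" "d2 + y = d3 + y'"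
      by blast
    moreover from this(3) have "d3 + (d2 + y) = y'"
      by simp
    ultimately have y: "y \<in> Y" "d2 + d3 + y \<in> Y"
      by (simp_all only: add.assoc add.left_commute[of d2 d3])
    then have "d1 + y \<in> Y"
      using Y(3)[of "d2 + d3 + y"] by (simp add: h123 ac_simps)
    then have "y \<in> ends X d1" "h + y \<in> ends X d1"
      using y Y Y(3)[of y] Y(3)[of "d1 + y"] by (auto simp: ends_def ac_simps)
    then have "h + y \<in> {y, d1 + y}"
      using ends_unique_sum[OF D(1)] by blast
    then show False
      using \<open>h \<noteq> d1\<close> unique_sums_sum_free[OF large D(2,3)] D(1) h123 by (auto simp: ac_simps)
  qed
  have "card X + card X \<le> card (X \<union> (+) d1 ` X) + 2"
    using card_Un_ge[of X "(+) d1 ` X"] D(1) by (simp add: card_inter_translate unique_sums_def)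
  moreover have "card (X \<union> (+) d1 ` X) + card ((+) d2 ` Y \<union> (+) d3 ` Y)
      \<le> ?N + card ((X \<union> (+) d1 ` X) \<inter> ((+) d2 ` Y \<union> (+) d3 ` Y))"
    using card_Un_ge[of "X \<union> (+) d1 ` X" "(+) d2 ` Y \<union> (+) d3 ` Y"]
      card_le_bit_vec[of "(X \<union> (+) d1 ` X) \<union> ((+) d2 ` Y \<union> (+) d3 ` Y)"] by simp
  moreover have "card ((+) d2 ` Y \<union> (+) d3 ` Y) = card Y + card Y"
    using disj by (simp add: card_Un_disjoint)
  moreover have "card ((X \<union> (+) d1 ` X) \<inter> ((+) d2 ` Y \<union> (+) d3 ` Y)) \<le> 8"
  proof -
    have "(X \<union> (+) d1 ` X) \<inter> ((+) d2 ` Y \<union> (+) d3 ` Y)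
        = ((X \<inter> (+) d2 ` Y) \<union> (X \<inter> (+) d3 ` Y))
          \<union> (((+) d1 ` X \<inter> (+) d2 ` Y) \<union> ((+) d1 ` X \<inter> (+) d3 ` Y))"
      by auto
    then have "card ((X \<union> (+) d1 ` X) \<inter> ((+) d2 ` Y \<union> (+) d3 ` Y))
        \<le> (card (X \<inter> (+) d2 ` Y) + card (X \<inter> (+) d3 ` Y))
          + (card ((+) d1 ` X \<inter> (+) d2 ` Y) + card ((+) d1 ` X \<inter> (+) d3 ` Y))"
      by (simp only: card_Un4_le)
    moreover have "card (X \<inter> (+) d2 ` Y) \<le> 2" "card (X \<inter> (+) d3 ` Y) \<le> 2"
      using D small[OF _ Y2(1), of X 0] small[OF _ Y3(1), of X 0] by simp_all
    moreover have "card ((+) d1 ` X \<inter> (+) d2 ` Y) \<le> 2" "card ((+) d1 ` X \<inter> (+) d3 ` Y) \<le> 2"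
      using D small[OF subset_refl Y2(2), of d1] small[OF subset_refl Y3(2), of d1] by simp_all
    ultimately show ?thesis by linarith
  qed
  ultimately have "2 * card X + 2 * card Y \<le> ?N + 10"
    by linarith
  \<comment> \<open>The two bounds add up to 6|X| <= 2 * 2^r + 18, while \<open>large\<close> gives
    6|X| >= 2 * 2^r + 20.\<close>
  with lower large show False
    by linarith
qed


section \<open>Odd relations\<close>

text \<open>Repetitions are allowed, and \<open>0 \<in> fold_sums D m\<close> expresses a relation
  of length m among elements of D.\<close>

primrec fold_sums :: "(bit ^ 'n) set \<Rightarrow> nat \<Rightarrow> (bit ^ 'n) set" where
  "fold_sums D 0 = {0}"
| "fold_sums D (Suc k) = D + fold_sums D k"

lemma fold_sums_1: "fold_sums D 1 = D"
  by (simp add: set_plus_def)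

lemma fold_sums_add: "fold_sums D (j + k) = fold_sums D j + fold_sums D k"
  by (induction j) (simp_all add: add.assoc)

lemma fold_sums_plusI:
  assumes "x \<in> fold_sums D j" "y \<in> fold_sums D k" "i = j + k"
  shows "x + y \<in> fold_sums D i"
  using assms by (auto simp: fold_sums_add)

lemma card_Un_translate:
  fixes X :: "(bit ^ 'n) set"
  assumes "p \<notin> X + X"
  shows "card (X \<union> (+) p ` X) = 2 * card X"
proof -
  have "X \<inter> (+) p ` X = {}"
  proof (rule ccontr)
    assume "X \<inter> (+) p ` X \<noteq> {}"
    then obtain x where "x \<in> X" "p + x \<in> X"
      by (auto simp: mem_translate_iff)
    then have "p + x + x \<in> X + X"
      by blast
    then show False
      using assms by (simp add: add.assoc)
  qed
  then show ?thesis
    by (simp add: card_Un_disjoint)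
qed

text \<open>
  Split a shortest odd relation into seven odd blocks indexed by the points of the Fano plane. The
  sums along its lines, together with \<open>0\<close>, form a group of order 8 whose nonzero elements are not in
  \<open>D + D\<close>, since otherwise there would be a shorter odd relation. Hence \<open>8 |D| \<le> 2\<^sup>r\<close>.
\<close>

lemma no_odd_relation:
  fixes D :: "(bit ^ 'n) set"
  assumes large: "CARD(bit ^ 'n) < 8 * card D"
    and no135: "0 \<notin> fold_sums D 1" "0 \<notin> fold_sums D 3" "0 \<notin> fold_sums D 5"
    and "odd m"
  shows "0 \<notin> fold_sums D m"
  using \<open>odd m\<close>
proof (induction m rule: less_induct)
  case (less m)
  show ?case
  proof
    assume zero: "0 \<in> fold_sums D m"
    have "m \<noteq> 1" "m \<noteq> 3" "m \<noteq> 5"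
      using zero no135 by auto
    then have "m \<ge> 7"
      using \<open>odd m\<close> by presburger
    \<comment> \<open>If y were also a sum of two elements of D, then y + y = 0 would be an odd
      relation of length j + 2 < m.\<close>
    have not_sum: "y \<notin> D + D" if "y \<in> fold_sums D j" "odd j" "j + 2 < m" for y j
    proof
      assume "y \<in> D + D"
      then have "y \<in> fold_sums D 2"
        by (simp add: numeral_2_eq_2 set_plus_def)
      then have "y + y \<in> fold_sums D (j + 2)"
        using fold_sums_plusI[OF that(1)] by blast
      then show False
        using less.IH[of "j + 2"] that by simp
    qed
    have "m = Suc (Suc (Suc (Suc (Suc (Suc (m - 6))))))"
      using \<open>m \<ge> 7\<close> by simp
    then have "0 \<in> D + (D + (D + (D + (D + (D + fold_sums D (m - 6))))))"
      using zero by (metis fold_sums.simps(2))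
    then obtain a b c d e f t where D: "a \<in> D" "b \<in> D" "c \<in> D" "d \<in> D" "e \<in> D" "f \<in> D"
      and t: "t \<in> fold_sums D (m - 6)" and rel: "0 = a + (b + (c + (d + (e + (f + t)))))"
      by (auto elim!: set_plus_elim)
    have three: "x + y + z \<in> fold_sums D 3" if "x \<in> D" "y \<in> D" "z \<in> D" for x y z
      using that by (auto simp: numeral_3_eq_3 set_plus_def add.assoc intro: exI[of _ 0])
    have two_t: "x + y + t \<in> fold_sums D (m - 4)" if "x \<in> D" "y \<in> D" for x y
    proof (rule fold_sums_plusI[OF _ t])
      show "x + y \<in> fold_sums D 2"
        using that by (auto simp: numeral_2_eq_2 set_plus_def)
      show "m - 4 = 2 + (m - 6)"
        using \<open>m \<ge> 7\<close> by simp
    qed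
    have t_eq: "t = a + (b + (c + (d + (e + f))))"
      using rel bit_vec_add_eq_0_iff[of t "a + (b + (c + (d + (e + f))))"] by (simp add: ac_simps)
    \<comment> \<open>The points are a, ..., f and t. Three lines generate the group: in a sum of
      two of them the common point cancels, and the remaining four points sum to the complementary
      line because the total is 0. A line has length 3 or m - 4, according to whether it avoids
      t.\<close>
    define p q r where "p = a + b + c" and "q = a + d + e" and "r = b + d + f"
    have short: "y \<notin> D + D" if "y \<in> fold_sums D 3 \<or> y \<in> fold_sums D (m - 4)" for y
    proof -
      have "odd (m - 4)" "m - 4 + 2 < m" "3 + 2 < m"
        using \<open>m \<ge> 7\<close> \<open>odd m\<close> by auto
      then show ?thesis
        using that not_sum[of y 3] not_sum[of y "m - 4"] by auto
    qed
    have pqr: "p \<notin> D + D" "q \<notin> D + D" "r \<notin> D + D" "p + q \<notin> D + D" "p + r \<notin> D + D"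
      "q + r \<notin> D + D" "p + q + r \<notin> D + D"
    proof -
      show "p \<notin> D + D" "q \<notin> D + D" "r \<notin> D + D"
        using D by (auto intro!: short three simp: p_def q_def r_def)
      have sums: "p + q = a + f + t" "p + r = b + e + t" "q + r = c + d + t" "p + q + r = c + e + f"
        by (simp_all add: p_def q_def r_def t_eq ac_simps)
      show "p + q \<notin> D + D" "p + r \<notin> D + D" "q + r \<notin> D + D"
        unfolding sums(1-3) using D by (auto intro!: short two_t)
      show "p + q + r \<notin> D + D"
        unfolding sums(4) using D by (auto intro!: short three)
    qed
    \<comment> \<open>Sums of two elements of V and its translate by x lie in V + V or in x + (V +
      V). This carries the non-membership through each doubling of the set.\<close>
    have sums: "x + u \<notin> V + V \<Longrightarrow> u \<notin> V + V \<Longrightarrow> u \<notin> (V \<union> (+) x ` V) + (V \<union> (+) x ` V)"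
      for x u :: "bit ^ 'n" and V
    proof
      assume *: "x + u \<notin> V + V" "u \<notin> V + V" "u \<in> (V \<union> (+) x ` V) + (V \<union> (+) x ` V)"
      then obtain v w where vw: "v \<in> V" "w \<in> V"
        "u = v + w \<or> u = x + v + w \<or> u = v + (x + w) \<or> u = (x + v) + (x + w)"
        by (auto elim!: set_plus_elim)
      then have "u = v + w \<or> x + u = v + w"
        by (auto simp: ac_simps)
      then show False
        using * vw by auto
    qed
    define D1 where "D1 = D \<union> (+) p ` D"
    define D2 where "D2 = D1 \<union> (+) q ` D1"
    have "card D1 = 2 * card D"
      unfolding D1_def by (rule card_Un_translate) (rule pqr)
    moreover have "card D2 = 2 * card D1"
      unfolding D2_def D1_def by (intro card_Un_translate sums pqr)
    moreover have "r \<notin> D2 + D2"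
      unfolding D2_def
    proof (intro sums)
      show "q + r \<notin> D1 + D1" "r \<notin> D1 + D1"
        unfolding D1_def using sums[of p "q + r" D] sums[of p r D] pqr by (simp_all add: add.assoc)
    qed
    then have "card (D2 \<union> (+) r ` D2) = 2 * card D2"
      by (rule card_Un_translate)
    ultimately show False
      using large card_le_bit_vec[of "D2 \<union> (+) r ` D2"] by linarith
  qed
qed

text \<open>The subgroup of even sums extends to a hyperplane that avoids the odd sums.\<close>

lemma exists_character:
  fixes D :: "(bit ^ 'n) set"
  assumes no_odd: "\<And>m. odd m \<Longrightarrow> 0 \<notin> fold_sums D m" and "d0 \<in> D"
  obtains \<phi> :: "bit ^ 'n \<Rightarrow> bool"
  where "\<And>x y. \<phi> (x + y) \<longleftrightarrow> \<phi> x \<noteq> \<phi> y" "\<And>d. d \<in> D \<Longrightarrow> \<phi> d"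
proof -
  define evens where "evens = (\<Union>k. fold_sums D (2 * k))"
  define good where "good K \<longleftrightarrow> evens \<subseteq> K \<and> d0 \<notin> K \<and> (\<forall>x\<in>K. \<forall>y\<in>K. x + y \<in> K)" for K
  have "good evens"
    unfolding good_def
  proof (intro conjI ballI)
    show "d0 \<notin> evens"
    proof
      assume "d0 \<in> evens"
      then obtain k where "d0 \<in> fold_sums D (2 * k)"
        by (auto simp: evens_def)
      then have "d0 + d0 \<in> fold_sums D (Suc (2 * k))"
        unfolding fold_sums.simps using \<open>d0 \<in> D\<close> by (intro set_plus_intro)
      then show False
        using no_odd[of "Suc (2 * k)"] by simp
    qed
    fix x y
    assume "x \<in> evens" "y \<in> evens"
    then obtain j k where "x \<in> fold_sums D (2 * j)" "y \<in> fold_sums D (2 * k)"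
      by (auto simp: evens_def)
    then have "x + y \<in> fold_sums D (2 * (j + k))"
      by (rule fold_sums_plusI) simp
    then show "x + y \<in> evens"
      unfolding evens_def by blast
  qed simp
  have "\<exists>K. good K \<and> (\<forall>L. good L \<longrightarrow> card L \<le> card K)"
  proof (rule ex_has_greatest_nat[of good evens card "CARD(bit ^ 'n) + 1", OF \<open>good evens\<close>])
    show "\<forall>L. good L \<longrightarrow> card L < CARD(bit ^ 'n) + 1"
      using card_le_bit_vec by (metis Suc_eq_plus1 less_Suc_eq_le)
  qed
  then obtain K where K: "good K" and max: "\<And>L. good L \<Longrightarrow> card L \<le> card K"
    by blast
  have closed: "x + y \<in> K" if "x \<in> K" "y \<in> K" for x y
    using K that by (simp add: good_def)
  have "0 \<in> evens"
    by (auto simp: evens_def intro!: exI[of _ 0])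
  then have "0 \<in> K"
    using K by (auto simp: good_def)
  \<comment> \<open>If both x and x + d0 were outside K, then K and x + K would form a larger good
    set. So K has index 2, with d0 in the other coset.\<close>
  have index: "x + d0 \<in> K" if "x \<notin> K" for x
  proof (rule ccontr)
    assume "x + d0 \<notin> K"
    have "good (K \<union> (+) x ` K)"
      unfolding good_def
    proof (intro conjI ballI)
      show "evens \<subseteq> K \<union> (+) x ` K"
        using K by (auto simp: good_def)
      show "d0 \<notin> K \<union> (+) x ` K"
        using K \<open>x + d0 \<notin> K\<close> by (auto simp: good_def mem_translate_iff)
      fix u v
      assume "u \<in> K \<union> (+) x ` K" "v \<in> K \<union> (+) x ` K"
      then have "(u \<in> K \<or> x + u \<in> K) \<and> (v \<in> K \<or> x + v \<in> K)"
        by (auto simp: mem_translate_iff)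
      moreover have "u + (x + v) = x + (u + v)" "x + u + v = x + (u + v)" "x + u + (x + v) = u + v"
        by (simp_all add: ac_simps)
      ultimately have "u + v \<in> K \<or> x + (u + v) \<in> K"
        using closed by metis
      then show "u + v \<in> K \<union> (+) x ` K"
        by (auto simp: mem_translate_iff)
    qed
    moreover have "x \<in> (+) x ` K"
      using \<open>0 \<in> K\<close> by (simp add: mem_translate_iff)
    then have "card K < card (K \<union> (+) x ` K)"
      using that by (intro psubset_card_mono) auto
    ultimately show False
      using max by fastforce
  qed
  have "d0 \<notin> K"
    using K by (simp add: good_def)
  have "x + y \<in> K \<longleftrightarrow> (x \<in> K \<longleftrightarrow> y \<in> K)" for x y
  proof -
    have "x + (x + y) = y" "x + y + y = x" "(x + d0) + (y + d0) = x + y"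
      by (simp_all add: ac_simps)
    then show ?thesis
      using closed index by metis
  qed
  moreover have "d \<notin> K" if "d \<in> D" for d
  proof
    assume "d \<in> K"
    have "d + d0 \<in> fold_sums D (2 * 1)"
      using that \<open>d0 \<in> D\<close> by (auto simp: numeral_2_eq_2 set_plus_def)
    then have "d + d0 \<in> K"
      using K unfolding good_def evens_def by blast
    then have "d + (d + d0) \<in> K"
      using \<open>d \<in> K\<close> closed by blast
    then show False
      using \<open>d0 \<notin> K\<close> by simp
  qed
  ultimately show ?thesis
    by (intro that[of "\<lambda>x. x \<notin> K"]) auto
qed


section \<open>Graphs in which every edge meets most edges\<close>

text \<open>
  Take a maximum family \<open>P\<close> of edges such that no edge meets two members of \<open>P\<close>. Maximality forces
  \<open>|P| \<ge> |X| - 1 - |E|\<close>, and every edge avoids at least \<open>|P| - 1\<close> members of \<open>P\<close>.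
\<close>

lemma edges_pairwise_meet:
  fixes E :: "'a set set" and X :: "'a set"
  assumes "finite X" and two: "\<And>e. e \<in> E \<Longrightarrow> e \<subseteq> X \<and> card e = 2"
    and cover: "X - {z} \<subseteq> \<Union>E"
    and few: "\<And>e. e \<in> E \<Longrightarrow> 2 * card {e' \<in> E. e' \<inter> e = {}} + 8 \<le> card X"
    and "p \<in> E" "q \<in> E"
  shows "p \<inter> q \<noteq> {}"
proof
  assume disj: "p \<inter> q = {}"
  have "finite E"
    using two \<open>finite X\<close> by (meson PowI finite_Pow_iff finite_subset subsetI)
  define avoid where "avoid e = {e' \<in> E. e' \<inter> e = {}}" for e
  define meets where "meets e = {e' \<in> E. e' \<inter> e \<noteq> {}}" for e
  have fin: "finite (avoid e)" "finite (meets e)" for e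
    using \<open>finite E\<close> by (auto simp: avoid_def meets_def)
  have fine: "finite e" if "e \<in> E" for e
    using two[OF that] \<open>finite X\<close> finite_subset by blast

  \<comment> \<open>An edge that meets both of the disjoint edges p and q is one of four pairs; all
    others avoid p or q, and there are at most |X| - 8 of these.\<close>
  have card_E_le: "card E + 4 \<le> card X"
  proof -
    obtain a b c d where abcd: "p = {a, b}" "q = {c, d}"
      using two[OF \<open>p \<in> E\<close>] two[OF \<open>q \<in> E\<close>] by (metis card_2_iff)
    have cross: "e \<in> {{a, c}, {a, d}, {b, c}, {b, d}}" if e: "e \<in> E" "e \<inter> p \<noteq> {}" "e \<inter> q \<noteq> {}" for e
    proof -
      obtain x y where xy: "x \<in> e" "x \<in> p" "y \<in> e" "y \<in> q"
        using e by blast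
      then have "x \<noteq> y"
        using disj by blast
      then have "e = {x, y}"
        using two[OF \<open>e \<in> E\<close>] xy fine[OF \<open>e \<in> E\<close>]
        by (metis card_2_iff card_subset_eq empty_subsetI insert_subset)
      then show ?thesis
        using xy abcd by auto
    qed
    have "E \<subseteq> (avoid p \<union> avoid q) \<union> {{a, c}, {a, d}, {b, c}, {b, d}}"
    proof
      fix e
      assume "e \<in> E"
      then show "e \<in> (avoid p \<union> avoid q) \<union> {{a, c}, {a, d}, {b, c}, {b, d}}"
        using cross[of e] unfolding avoid_def by blast
    qed
    then have "card E \<le> card ((avoid p \<union> avoid q) \<union> {{a, c}, {a, d}, {b, c}, {b, d}})"
      by (rule card_mono[rotated]) (simp add: fin)
    also have "\<dots> \<le> (card (avoid p) + card (avoid q)) + card {{a, c}, {a, d}, {b, c}, {b, d}}"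
      by (rule order_trans[OF card_Un_le add_right_mono[OF card_Un_le]])
    also have "card {{a, c}, {a, d}, {b, c}, {b, d}} \<le> 4"
      using card_length[of "[{a, c}, {a, d}, {b, c}, {b, d}]"] by simp
    finally show ?thesis
      using few[OF \<open>p \<in> E\<close>] few[OF \<open>q \<in> E\<close>] by (simp add: avoid_def)
  qed

  \<comment> \<open>The edge e may itself be a member of P, so distinct members are disjoint: P is
    an induced matching.\<close>
  define separated where
    "separated P \<longleftrightarrow> P \<subseteq> E \<and> (\<forall>e\<in>E. \<forall>x\<in>P. \<forall>y\<in>P. e \<inter> x \<noteq> {} \<longrightarrow> e \<inter> y \<noteq> {} \<longrightarrow> x = y)" for P
  have sep_p: "separated {p}"
    using \<open>p \<in> E\<close> by (auto simp: separated_def)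
  have "\<exists>P. separated P \<and> (\<forall>Q. separated Q \<longrightarrow> card Q \<le> card P)"
  proof (rule ex_has_greatest_nat[of separated "{p}" card "card E + 1", OF sep_p])
    show "\<forall>Q. separated Q \<longrightarrow> card Q < card E + 1"
      using \<open>finite E\<close> by (auto simp: separated_def less_Suc_eq_le intro: card_mono)
  qed
  then obtain P where P: "separated P" and max: "\<And>Q. separated Q \<Longrightarrow> card Q \<le> card P"
    by blast
  have sep: "x = y" if "e \<in> E" "x \<in> P" "y \<in> P" "e \<inter> x \<noteq> {}" "e \<inter> y \<noteq> {}" for e x y
    using P that unfolding separated_def by blast
  have "P \<subseteq> E" "finite P"
    using P \<open>finite E\<close> finite_subset by (auto simp: separated_def)
  have "card P \<ge> 1"
    using max[OF sep_p] by simp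

  \<comment> \<open>\<open>E1\<close> collects the edges that meet a member of P, and each meets
    only one. The edges at x in P cover at most one vertex more than their number: x gives two
    vertices, every other edge at most one new vertex.\<close>
  have card_X_le: "card X \<le> card E + card P + 1"
  proof -
    define E1 where "E1 = (\<Union>x\<in>P. meets x)"
    have "E1 \<subseteq> E"
      by (auto simp: E1_def meets_def)
    have card_E1: "card E1 = (\<Sum>x\<in>P. card (meets x))"
      unfolding E1_def
    proof (rule card_UN_disjoint)
      show "\<forall>x\<in>P. \<forall>y\<in>P. x \<noteq> y \<longrightarrow> meets x \<inter> meets y = {}"
        unfolding meets_def using sep by blast
    qed (use \<open>finite P\<close> fin in auto)
    have "card (\<Union>(meets x)) \<le> card (meets x) + 1" if "x \<in> P" for x
    proof -
      have "x \<in> E"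
        using that \<open>P \<subseteq> E\<close> by blast
      then have x: "x \<in> meets x" "card x = 2"
        using two[OF \<open>x \<in> E\<close>] by (auto simp: meets_def)
      have "card (e - x) \<le> 1" if "e \<in> meets x" for e
      proof -
        have "e \<in> E" "e \<inter> x \<noteq> {}"
          using that by (auto simp: meets_def)
        then have "card (e \<inter> x) \<ge> 1"
          using fine by (metis card_0_eq finite_Int less_one not_le)
        then show ?thesis
          using two[OF \<open>e \<in> E\<close>] fine[OF \<open>e \<in> E\<close>] by (simp add: card_Diff_subset_Int)
      qed
      then have "card (\<Union>e\<in>meets x - {x}. e - x) \<le> card (meets x - {x})"
        using card_UN_le[of "meets x - {x}" "\<lambda>e. e - x"] fin
          sum_bounded_above[of "meets x - {x}" "\<lambda>e. card (e - x)" 1] by fastforce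
      moreover have "\<Union>(meets x) = x \<union> (\<Union>e\<in>meets x - {x}. e - x)"
        using x by auto
      ultimately have "card (\<Union>(meets x)) \<le> 2 + card (meets x - {x})"
        using card_Un_le[of x "\<Union>e\<in>meets x - {x}. e - x"] x by simp
      then show ?thesis
        using x fin by (metis (no_types, lifting) Suc_eq_plus1 add_2_eq_Suc card.remove plus_1_eq_Suc add.commute)
    qed
    then have "(\<Sum>x\<in>P. card (\<Union>(meets x))) \<le> card E1 + card P"
      using sum_mono[of P "\<lambda>x. card (\<Union>(meets x))" "\<lambda>x. card (meets x) + 1"]
      unfolding card_E1 sum.distrib by simp
    moreover have "card (\<Union>x\<in>P. \<Union>(meets x)) \<le> (\<Sum>x\<in>P. card (\<Union>(meets x)))"
      using \<open>finite P\<close> by (rule card_UN_le)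
    moreover have "(\<Union>x\<in>P. \<Union>(meets x)) = \<Union>E1"
      by (auto simp: E1_def)
    ultimately have card_UE1: "card (\<Union>E1) \<le> card E1 + card P"
      by simp

    \<comment> \<open>If both ends of e were new, e would be disjoint from every edge of
      \<open>E1\<close>. No edge could then meet e and a member of P, so adding e to P would
      contradict maximality.\<close>
    have "card (e - \<Union>E1) \<le> 1" if e: "e \<in> E - E1" for e
    proof (rule ccontr)
      assume "\<not> card (e - \<Union>E1) \<le> 1"
      moreover have "card e = 2" "finite e"
        using e two fine by auto
      ultimately have "e - \<Union>E1 = e"
        by (metis Diff_subset card_seteq not_less_eq_eq numeral_2_eq_2 One_nat_def)
      then have far: "e \<inter> \<Union>E1 = {}"
        by blast
      have "separated (insert e P)"
        unfolding separated_def
      proof (intro conjI ballI impI)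
        show "insert e P \<subseteq> E"
          using e \<open>P \<subseteq> E\<close> by blast
        fix f x y
        assume f: "f \<in> E" "x \<in> insert e P" "y \<in> insert e P" "f \<inter> x \<noteq> {}" "f \<inter> y \<noteq> {}"
        have no: False if "f \<inter> e \<noteq> {}" "w \<in> P" "f \<inter> w \<noteq> {}" for w
        proof -
          have "f \<in> E1"
            using that f(1) by (auto simp: E1_def meets_def)
          then show False
            using far that(1) by blast
        qed
        show "x = y"
          using f no sep[OF f(1)] by blast
      qed
      moreover have "e \<notin> P"
      proof
        assume "e \<in> P"
        then have "e \<in> E1"
          using e \<open>card e = 2\<close> by (auto simp: E1_def meets_def)
        then show False
          using e by blast
      qed
      ultimately show False
        using max[of "insert e P"] \<open>finite P\<close> by simp
    qed
    then have "card (\<Union>e\<in>E - E1. e - \<Union>E1) \<le> card (E - E1)"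
      using card_UN_le[of "E - E1" "\<lambda>e. e - \<Union>E1"] \<open>finite E\<close>
        sum_bounded_above[of "E - E1" "\<lambda>e. card (e - \<Union>E1)" 1] by fastforce
    moreover have "X \<subseteq> insert z (\<Union>E1 \<union> (\<Union>e\<in>E - E1. e - \<Union>E1))"
      using cover by blast
    then have "card X \<le> card (insert z (\<Union>E1 \<union> (\<Union>e\<in>E - E1. e - \<Union>E1)))"
      by (rule card_mono[rotated]) (use \<open>finite E\<close> finite_subset[OF \<open>E1 \<subseteq> E\<close>] \<open>E1 \<subseteq> E\<close> fine in auto)
    then have "card X \<le> Suc (card (\<Union>E1 \<union> (\<Union>e\<in>E - E1. e - \<Union>E1)))"
      by (rule order_trans) (simp add: card_insert_le_m1)
    moreover have "card (E - E1) + card E1 = card E"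
      using \<open>E1 \<subseteq> E\<close> \<open>finite E\<close> by (metis card_Diff_subset card_mono finite_subset le_add_diff_inverse2)
    ultimately show ?thesis
      using card_UE1 card_Un_le[of "\<Union>E1" "\<Union>e\<in>E - E1. e - \<Union>E1"] by linarith
  qed

  have card_X_le2: "card X \<le> 2 * card E + 1"
  proof -
    have "card (\<Union>E) \<le> (\<Sum>e\<in>E. card e)"
      using card_UN_le[OF \<open>finite E\<close>, of "\<lambda>e. e"] by simp
    also have "\<dots> = 2 * card E"
      using two by simp
    finally have "card (\<Union>E) \<le> 2 * card E" .
    moreover have "card X \<le> card (insert z (\<Union>E))"
      by (rule card_mono) (use \<open>finite E\<close> fine cover in auto)
    moreover have "card (insert z (\<Union>E)) \<le> Suc (card (\<Union>E))"
      by (simp add: card_insert_le_m1)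
    ultimately show ?thesis
      by linarith
  qed

  \<comment> \<open>Count the disjoint pairs of an edge and a member of P: each edge meets at most
    one member.\<close>
  have double_count: "(card P - 1) * card E \<le> (\<Sum>x\<in>P. card (avoid x))"
  proof -
    have "card P - 1 \<le> card {x \<in> P. e \<inter> x = {}}" if "e \<in> E" for e
    proof -
      have "card {x \<in> P. e \<inter> x \<noteq> {}} \<le> 1"
        using sep[OF that] \<open>finite P\<close> by (simp add: card_le_Suc0_iff_eq)
      moreover have "card P = card {x \<in> P. e \<inter> x = {}} + card {x \<in> P. e \<inter> x \<noteq> {}}"
        using \<open>finite P\<close> by (subst card_Un_disjoint[symmetric]) (auto intro: arg_cong[of _ _ card])
      ultimately show ?thesis by linarith
    qed
    then have "(card P - 1) * card E \<le> (\<Sum>e\<in>E. card {x \<in> P. e \<inter> x = {}})"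
      using sum_bounded_below[of E "card P - 1" "\<lambda>e. card {x \<in> P. e \<inter> x = {}}"] by (simp add: mult.commute)
    also have "\<dots> = (\<Sum>x\<in>P. card {e \<in> E. e \<inter> x = {}})"
      by (rule sum_multicount_gen[OF \<open>finite E\<close> \<open>finite P\<close>]) auto
    finally show ?thesis
      by (simp add: avoid_def)
  qed
  have "(\<Sum>x\<in>P. 2 * card (avoid x) + 8) \<le> card P * card X"
    using sum_bounded_above[of P "\<lambda>x. 2 * card (avoid x) + 8" "card X"] few \<open>P \<subseteq> E\<close>
    by (auto simp: avoid_def)
  then have "2 * (\<Sum>x\<in>P. card (avoid x)) + 8 * card P \<le> card P * card X"
    unfolding sum.distrib by (simp add: sum_distrib_left mult.commute)
  with double_count have main: "2 * ((card P - 1) * card E) + 8 * card P \<le> card P * card X"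
    by linarith
  \<comment> \<open>Integers avoid truncated subtraction in the nonlinear estimate.\<close>
  define k n e where "k = int (card P)" and "n = int (card X)" and "e = int (card E)"
  have "int (2 * ((card P - 1) * card E) + 8 * card P) \<le> int (card P * card X)"
    using main by (simp only: of_nat_le_iff)
  then have "2 * ((k - 1) * e) + 8 * k \<le> k * n"
    using \<open>card P \<ge> 1\<close> by (simp add: k_def n_def e_def of_nat_diff)
  then have ineqs: "n \<le> e + k + 1" "n \<le> 2 * e + 1" "e + 4 \<le> n" "2 * ((k - 1) * e) + 8 * k \<le> k * n"
    using card_X_le card_X_le2 card_E_le by (auto simp: k_def n_def e_def)
  then have "k \<ge> 3"
    by linarith
  \<comment> \<open>Since 2(k - 1)e = 2(k - 2)e + 2e, the last inequality becomes 2e + 7k + 2 <= 2n,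
    whereas the first one gives 2n <= 2e + 2k + 2.\<close>
  have "(k - 2) * (n - 1) \<le> (k - 2) * (2 * e)"
    using ineqs \<open>k \<ge> 3\<close> by (intro mult_left_mono) auto
  then show False
    using ineqs \<open>k \<ge> 3\<close> by (simp add: algebra_simps)
qed

text \<open>Pairwise meeting edges form a star or a triangle: for an edge {a, b}, an edge missing a
  and an edge missing b meet in a third point c, and every edge then lies in {a, b, c}. With z this
  covers at most 4 vertices.\<close>

lemma pairwise_meeting_edges_common_vertex:
  fixes E :: "'a set set" and X :: "'a set"
  assumes two: "\<And>e. e \<in> E \<Longrightarrow> card e = 2"
    and meet: "\<And>p q. p \<in> E \<Longrightarrow> q \<in> E \<Longrightarrow> p \<inter> q \<noteq> {}"
    and cover: "X - {z} \<subseteq> \<Union>E" and "card X \<ge> 5"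
  obtains s where "\<And>e. e \<in> E \<Longrightarrow> s \<in> e"
proof (rule ccontr)
  assume "\<not> thesis"
  then have avoid: "\<exists>e\<in>E. s \<notin> e" for s
    using that by blast
  have fine: "finite e" if "e \<in> E" for e
    using two[OF that] by (metis card.infinite zero_neq_numeral)
  have pair: "e = {x, y}" if "e \<in> E" "x \<in> e" "y \<in> e" "x \<noteq> y" for e x y
    using two[OF that(1)] that(2-4) fine[OF that(1)]
    by (metis card_2_iff card_subset_eq empty_subsetI insert_subset)
  obtain p where "p \<in> E"
    using avoid by blast
  then obtain a b where p: "p = {a, b}" "a \<noteq> b"
    using two by (meson card_2_iff)
  obtain q where q: "q \<in> E" "a \<notin> q"
    using avoid by blast
  then have "b \<in> q"
    using meet[OF \<open>p \<in> E\<close> q(1)] p by blast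
  obtain r where r: "r \<in> E" "b \<notin> r"
    using avoid by blast
  then have "a \<in> r"
    using meet[OF \<open>p \<in> E\<close> r(1)] p by blast
  obtain c where c: "c \<in> q" "c \<in> r"
    using meet[OF q(1) r(1)] by blast
  have "c \<noteq> a" "c \<noteq> b"
    using c q r by auto
  then have qr: "q = {b, c}" "r = {a, c}"
    using pair q r c \<open>b \<in> q\<close> \<open>a \<in> r\<close> by metis+
  have "e \<subseteq> {a, b, c}" if "e \<in> E" for e
  proof -
    have "e \<inter> {a, b} \<noteq> {}" "e \<inter> {b, c} \<noteq> {}" "e \<inter> {a, c} \<noteq> {}"
      using meet[OF that] \<open>p \<in> E\<close> q(1) r(1) p qr by metis+
    then have "a \<in> e \<and> b \<in> e \<or> b \<in> e \<and> c \<in> e \<or> a \<in> e \<and> c \<in> e"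
      by blast
    then have "e = {a, b} \<or> e = {b, c} \<or> e = {a, c}"
      using pair[OF that] p(2) \<open>c \<noteq> a\<close> \<open>c \<noteq> b\<close> by metis
    then show ?thesis
      by blast
  qed
  then have "X \<subseteq> set [z, a, b, c]"
    using cover by fastforce
  then have "card X \<le> card (set [z, a, b, c])"
    by (rule card_mono[rotated]) simp
  also have "\<dots> \<le> 4"
    using card_length[of "[z, a, b, c]"] by simp
  finally show False
    using \<open>card X \<ge> 5\<close> by simp
qed


section \<open>Spanning stars of unique sums\<close>

text \<open>The exceptional vertex z will be 0, because minimality of A gives edges only at the
  elements of A.\<close>

lemma spanning_star:
  fixes X :: "(bit ^ 'n) set"
  assumes large: "CARD(bit ^ 'n) + 10 \<le> 3 * card X"
    and cover: "\<And>x. x \<in> X - {z} \<Longrightarrow> \<exists>d\<in>unique_sums X. x \<in> ends X d"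
  obtains s where "s \<in> X" "\<And>x. x \<in> X \<Longrightarrow> x \<noteq> z \<Longrightarrow> x \<noteq> s \<Longrightarrow> x + s \<in> unique_sums X"
proof -
  define D where "D = unique_sums X"
  define E where "E = ends X ` D"
  have two: "e \<subseteq> X \<and> card e = 2" if "e \<in> E" for e
    using that by (auto simp: E_def D_def ends_def unique_sums_def)
  have cover': "X - {z} \<subseteq> \<Union>E"
    using cover by (auto simp: E_def D_def)
  have card_E: "card E = card D"
    by (simp add: E_def D_def card_image inj_on_ends)

  have card_X_le: "card X \<le> 2 * card D + 1"
  proof -
    have "card X \<le> card (insert z (\<Union>E))"
      by (rule card_mono) (use cover' in auto)
    also have "\<dots> \<le> Suc (card (\<Union>E))"
      by (simp add: card_insert_le_m1)
    also have "card (\<Union>E) \<le> (\<Sum>e\<in>E. card e)"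
      using card_UN_le[of E "\<lambda>e. e"] by simp
    also have "\<dots> = 2 * card E"
      using two by simp
    finally show ?thesis
      by (simp add: card_E)
  qed
  then have D_large: "CARD(bit ^ 'n) < 8 * card D"
    using large by linarith
  then obtain d0 where "d0 \<in> D"
    by fastforce

  have "0 \<notin> fold_sums D 1" "0 \<notin> fold_sums D 3" "0 \<notin> fold_sums D 5"
  proof -
    show "0 \<notin> fold_sums D 1"
      unfolding fold_sums_1 by (auto simp: D_def unique_sums_def)
    show "0 \<notin> fold_sums D 3"
    proof
      assume "0 \<in> fold_sums D 3"
      then have "0 \<in> D + (D + (D + {0}))"
        by (simp only: numeral_3_eq_3 fold_sums.simps)
      then obtain a b c where "a \<in> D" "b \<in> D" "c \<in> D" "0 = a + (b + (c + 0))"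
        by (auto elim!: set_plus_elim)
      then show False
        using unique_sums_sum_free[OF large, of b c] bit_vec_add_eq_0_iff[of a "b + c"]
        by (simp add: D_def)
    qed
    show "0 \<notin> fold_sums D 5"
    proof
      assume "0 \<in> fold_sums D 5"
      then have "0 \<in> D + (D + (D + (D + (D + {0}))))"
        by (simp add: eval_nat_numeral)
      then obtain a b c d e where "a \<in> D" "b \<in> D" "c \<in> D" "d \<in> D" "e \<in> D"
        and rel: "0 = a + (b + (c + (d + (e + 0))))"
        by (auto elim!: set_plus_elim)
      moreover have "a + b + c = d + e"
        using rel bit_vec_add_eq_0_iff[of "a + b + c" "d + e"] by (metis add.assoc add.right_neutral)
      ultimately show False
        using unique_sums_no_five_relation[OF large, of a b c d e] by (simp add: D_def)
    qed
  qed
  then have "0 \<notin> fold_sums D m" if "odd m" for m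
    using no_odd_relation[OF D_large] that by blast
  then obtain \<phi> where \<phi>: "\<And>x y. \<phi> (x + y) \<longleftrightarrow> \<phi> x \<noteq> \<phi> y" and \<phi>_D: "\<And>d. d \<in> D \<Longrightarrow> \<phi> d"
    using exists_character \<open>d0 \<in> D\<close> by metis
  define W where "W = {x. \<phi> x}"
  have card_W: "2 * card W = CARD(bit ^ 'n)"
  proof -
    have "- W = (+) d0 ` W"
      using \<phi>_D[OF \<open>d0 \<in> D\<close>] by (auto simp: W_def mem_translate_iff \<phi>)
    then have "card (- W) = card W"
      by simp
    then show ?thesis
      using card_Un_disjoint[of W "- W"] by (simp add: Compl_partition)
  qed

  have few: "2 * card {e' \<in> E. e' \<inter> e = {}} + 8 \<le> card X" if e_in: "e \<in> E" for e
  proof -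
    obtain d where d: "d \<in> D" "e = ends X d"
      using e_in by (auto simp: E_def)
    obtain a where "a \<in> e"
      using two[OF e_in] by fastforce
    define b where "b = d + a"
    have e: "e = {a, b}"
      using ends_unique_sum[of d X a] d \<open>a \<in> e\<close> by (simp add: D_def b_def)
    \<comment> \<open>P and Q are the parts of a + X and b + X inside W. As the value of the
      character at d is true, each x in X contributes to exactly one of them.\<close>
    define P where "P = (+) a ` {x \<in> X. \<phi> (a + x)}"
    define Q where "Q = (+) b ` {x \<in> X. \<phi> (b + x)}"
    \<comment> \<open>A common point x gives the representation (a + x) + (b + x) of d, so x is 0 or
      d; but 0 is not in W.\<close>
    have "P \<inter> Q \<subseteq> {d}"
    proof
      fix x
      assume x: "x \<in> P \<inter> Q"
      then have mem: "a + x \<in> X" "b + x \<in> X" "\<phi> x"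
        by (auto simp: P_def Q_def mem_translate_iff)
      then have "a + x \<in> ends X d"
        by (simp add: ends_def b_def add.assoc)
      then have "a + x = a \<or> a + x = d + a"
        using e d by (auto simp: b_def)
      then have "x = 0 \<or> x = d"
        by (metis add.commute add.right_neutral bit_vec_add_left_cancel)
      moreover have "\<not> \<phi> 0"
        using \<phi>[of 0 0] by simp
      ultimately show "x \<in> {d}"
        using mem by auto
    qed
    then have "card (P \<inter> Q) \<le> 1"
      using card_mono[of "{d}" "P \<inter> Q"] by simp
    moreover have "card P + card Q = card X"
    proof -
      have "{x \<in> X. \<phi> (b + x)} = X - {x \<in> X. \<phi> (a + x)}"
        using \<phi>_D[OF d(1)] by (auto simp: b_def \<phi>)
      then show ?thesis
        by (simp add: P_def Q_def card_Diff_subset card_mono)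
    qed
    ultimately have PQ: "card X \<le> card (P \<union> Q) + 1"
      using card_Un_ge[of P Q] by simp
    \<comment> \<open>If d' were in P, then a + d' would be in X and a would be an end of the edge
      labelled d'; similarly for Q and b.\<close>
    have "{e' \<in> E. e' \<inter> e = {}} \<subseteq> ends X ` (W - (P \<union> Q))"
    proof
      fix e'
      assume "e' \<in> {e' \<in> E. e' \<inter> e = {}}"
      then obtain d' where d': "d' \<in> D" "e' = ends X d'" "a \<notin> ends X d'" "b \<notin> ends X d'"
        using e by (auto simp: E_def)
      have "a \<in> X" "b \<in> X"
        using two[OF e_in] e by auto
      then have "d' \<notin> P \<union> Q"
        using d' by (auto simp: P_def Q_def mem_translate_iff ends_def ac_simps)
      then show "e' \<in> ends X ` (W - (P \<union> Q))"
        using d' \<phi>_D by (auto simp: W_def)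
    qed
    then have "card {e' \<in> E. e' \<inter> e = {}} \<le> card (ends X ` (W - (P \<union> Q)))"
      by (rule card_mono[rotated]) simp
    also have "\<dots> \<le> card (W - (P \<union> Q))"
      by (rule card_image_le) simp
    finally have "card {e' \<in> E. e' \<inter> e = {}} \<le> card (W - (P \<union> Q))" .
    moreover have "P \<union> Q \<subseteq> W"
      by (auto simp: P_def Q_def W_def)
    then have "card (W - (P \<union> Q)) + card (P \<union> Q) = card W"
      by (simp add: card_Diff_subset card_mono)
    \<comment> \<open>At most 2^r / 2 - |X| + 1 edges avoid e; twice this plus 8 is 2^r + 10 - 2|X|,
      at most |X| by \<open>large\<close>.\<close>
    ultimately show ?thesis
      using PQ card_W large by linarith
  qed

  have meet: "p \<inter> q \<noteq> {}" if "p \<in> E" "q \<in> E" for p q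
    by (rule edges_pairwise_meet[OF _ two cover' few that]) auto
  have "ends X d0 \<in> E"
    using \<open>d0 \<in> D\<close> by (simp add: E_def)
  then have "card X \<ge> 5"
    using few by fastforce
  then obtain s where s: "\<And>e. e \<in> E \<Longrightarrow> s \<in> e"
    using pairwise_meeting_edges_common_vertex[of E X z] two meet cover' by metis
  show ?thesis
  proof (rule that)
    show "s \<in> X"
      using s two \<open>ends X d0 \<in> E\<close> by blast
    fix x
    assume "x \<in> X" "x \<noteq> z" "x \<noteq> s"
    then obtain d where d: "d \<in> D" "x \<in> ends X d"
      using cover by (auto simp: D_def)
    then have "s \<in> {x, d + x}"
      using s[of "ends X d"] ends_unique_sum[of d X x] by (simp add: D_def E_def)
    then have "s = d + x"
      using \<open>x \<noteq> s\<close> by simp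
    then have "x + s = d"
      by (simp add: ac_simps)
    then show "x + s \<in> unique_sums X"
      using d by (simp add: D_def)
  qed
qed

section \<open>Sum-free sets and 1-saturating sets\<close>

lemma sum_free_0: "sum_free S \<Longrightarrow> 0 \<notin> (S :: (bit ^ 'n) set)"
  unfolding sum_free_def by (metis IntI add.right_neutral empty_iff set_plus_intro)

lemma sum_freeD:
  assumes "sum_free S" "x \<in> S" "y \<in> S"
  shows "x + y \<notin> S"
  using assms unfolding sum_free_def by blast

lemma sum_freeI:
  assumes "\<And>x y. x \<in> S \<Longrightarrow> y \<in> S \<Longrightarrow> x + y \<notin> S"
  shows "sum_free S"
  using assms unfolding sum_free_def by (auto elim!: set_plus_elim)

text \<open>A nonzero g that is not covered could be added to S: g + x = y with x, y in S would mean
  g = x + y, and g + g is 0.\<close>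

lemma maximal_sum_free_cover:
  fixes S :: "(bit ^ 'n) set"
  assumes "maximal_sum_free S" "g \<noteq> 0"
  shows "g \<in> S \<or> (\<exists>x\<in>S. \<exists>y\<in>S. g = x + y)"
proof (rule ccontr)
  assume g: "\<not> ?thesis"
  have S: "sum_free S"
    using assms(1) by (simp add: maximal_sum_free_def)
  have "sum_free (insert g S)"
  proof (rule sum_freeI)
    fix x y
    assume xy: "x \<in> insert g S" "y \<in> insert g S"
    have "g + x \<notin> S" if "x \<in> S" for x
    proof
      assume "g + x \<in> S"
      moreover have "g = (g + x) + x"
        by (simp add: add.assoc)
      ultimately show False
        using g that by blast
    qed
    moreover have "g + x \<noteq> g" if "x \<in> S" for x
      using that sum_free_0[OF S] by auto
    moreover have "x + y \<notin> insert g S" if "x \<in> S" "y \<in> S"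
      using that g sum_freeD[OF S that] by blast
    moreover have "0 \<notin> insert g S"
      using sum_free_0[OF S] assms(2) by auto
    ultimately show "x + y \<notin> insert g S"
      using xy by (metis add.commute bit_vec_add_self insert_iff)
  qed
  moreover have "S \<subset> insert g S"
    using g by blast
  ultimately show False
    using assms(1) by (auto simp: maximal_sum_free_def)
qed

text \<open>Adjoining 0 absorbs A into the sumset, which is invariant under translation.
  Nonemptiness matters for g = 0, where 0 + 0 must be replaced by some a + a.\<close>

lemma one_saturating_iff:
  fixes A :: "(bit ^ 'n) set"
  assumes "A \<noteq> {}" "0 \<notin> A"
  shows "one_saturating A \<longleftrightarrow> (\<forall>g. \<exists>x\<in>insert 0 A. \<exists>y\<in>insert 0 A. g = x + y)"
proof -
  have "g \<in> A \<union> (A + A) \<longleftrightarrow> (\<exists>x\<in>insert 0 A. \<exists>y\<in>insert 0 A. g = x + y)" for g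
  proof -
    obtain a where "a \<in> A"
      using assms(1) by blast
    moreover have "0 = a + a"
      by simp
    ultimately show ?thesis
      by (auto simp: set_plus_def)
  qed
  then show ?thesis
    using assms(2) unfolding one_saturating_def by blast
qed

text \<open>The translated set has the same sumset as S with 0, which is everything. Sum-freeness
  makes s a vertex joined to all others, so the removal of any element destroys the sum on some edge
  at s.\<close>

lemma minimal_one_saturating_translate:
  fixes S :: "(bit ^ 'n) set"
  assumes S: "maximal_sum_free S" and s: "s \<in> insert 0 S" and "A \<noteq> {}"
    and A: "insert 0 A = (+) s ` insert 0 S" "0 \<notin> A"
  shows "minimal_one_saturating A"
  unfolding minimal_one_saturating_def
proof (intro conjI allI impI)
  have free: "sum_free S"
    using S by (simp add: maximal_sum_free_def)
  have mem: "x \<in> insert 0 A \<longleftrightarrow> s + x \<in> insert 0 S" for x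
    unfolding A(1) by (rule mem_translate_iff)
  have "\<exists>x\<in>insert 0 A. \<exists>y\<in>insert 0 A. g = x + y" for g
  proof -
    have "\<exists>x\<in>insert 0 S. \<exists>y\<in>insert 0 S. g = x + y"
      using maximal_sum_free_cover[OF S, of g] by force
    then obtain x y where "x \<in> insert 0 S" "y \<in> insert 0 S" "g = x + y"
      by blast
    moreover from this(3) have "g = (s + x) + (s + y)"
      by (simp add: ac_simps)
    ultimately show ?thesis
      using mem by (metis bit_vec_add_left_cancel)
  qed
  then show "one_saturating A"
    using one_saturating_iff[OF \<open>A \<noteq> {}\<close> A(2)] by blast
  fix B
  assume "B \<subset> A"
  then obtain a where a: "a \<in> A" "a \<notin> B"
    by blast
  show "\<not> one_saturating B"
  proof
    assume "one_saturating B"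
    have unique: "{u, v} = {x, s}"
      if "u \<in> insert 0 A" "v \<in> insert 0 A" "x \<in> insert 0 A" "x \<noteq> s" "u + v = x + s" for u v x
    proof -
      have "s + x \<in> S" "s + u \<in> insert 0 S" "s + v \<in> insert 0 S"
        using that mem by auto
      moreover have "(s + u) + (s + v) = s + x"
        using that(5) by (simp add: ac_simps)
      ultimately have "s + u = 0 \<or> s + v = 0"
        using sum_freeD[OF free] by (metis insert_iff)
      then have "u = s \<or> v = s"
        by auto
      then show ?thesis
        using that(5) by (auto simp: add.commute)
    qed
    \<comment> \<open>The edge {x, s} contains a: for a = s its other end is 0, so the lost sum is s
      itself.\<close>
    define x where "x = (if a = s then 0 else a)"
    have x: "x \<in> insert 0 A" "x \<noteq> s" "a \<in> {x, s}"
      using a A(2) by (auto simp: x_def)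
    have "B \<noteq> {}"
      using \<open>one_saturating B\<close> unfolding one_saturating_def by (auto simp: set_plus_def)
    moreover have "0 \<notin> B"
      using \<open>B \<subset> A\<close> A(2) by blast
    ultimately obtain u v where uv: "u \<in> insert 0 B" "v \<in> insert 0 B" "x + s = u + v"
      using one_saturating_iff \<open>one_saturating B\<close> by metis
    then have "{u, v} = {x, s}"
      using unique[of u v x] x \<open>B \<subset> A\<close> by auto
    then have "a \<in> insert 0 B"
      using x(3) uv by auto
    then show False
      using a A(2) by auto
  qed
qed

theorem theorem1p1:
  fixes A :: "(bit ^ 'n) set"
  assumes "A \<subseteq> UNIV - {0}"
    and "real (card A) > 1 / 3 * 2 ^ CARD('n) + 2"
  shows "minimal_one_saturating A \<longleftrightarrow>
    (\<exists>S s. maximal_sum_free S \<and> s \<in> S \<union> {0} \<and> A = (s +o (S \<union> {0})) - {0})"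
proof -
  define X where "X = insert 0 A"
  have "0 \<notin> A"
    using assms(1) by blast
  have "real (2 ^ CARD('n) + 6) < real (3 * card A)"
    using assms(2) by simp
  then have "2 ^ CARD('n) + 6 < 3 * card A"
    by (simp only: of_nat_less_iff)
  then have large_A: "CARD(bit ^ 'n) + 6 < 3 * card A"
    by (simp only: card_bit_vec)
  moreover have "card X = card A + 1"
    using \<open>0 \<notin> A\<close> by (simp add: X_def)
  \<comment> \<open>By integrality 3|A| >= 2^r + 7, and the element 0 of X adds 3.\<close>
  ultimately have large: "CARD(bit ^ 'n) + 10 \<le> 3 * card X"
    by linarith
  have card_A: "card A \<ge> 2"
    using large_A by linarith
  then have "A \<noteq> {}"
    by auto
  have translate: "s +o (S \<union> {0}) = (+) s ` insert 0 S" for s and S :: "(bit ^ 'n) set"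
    by (auto simp: elt_set_plus_def)
  show ?thesis
  proof
    assume min: "minimal_one_saturating A"
    have X_cover: "\<exists>x\<in>X. \<exists>y\<in>X. g = x + y" for g
      using min one_saturating_iff[OF \<open>A \<noteq> {}\<close> \<open>0 \<notin> A\<close>]
      by (auto simp: minimal_one_saturating_def X_def)
    \<comment> \<open>Some g is lost when a is removed, so every representation of g in X uses a,
      and its partner is then determined.\<close>
    have "\<exists>d\<in>unique_sums X. a \<in> ends X d" if "a \<in> X - {0}" for a
    proof -
      have "a \<in> A"
        using that by (auto simp: X_def)
      define B where "B = A - {a}"
      have "card B \<ge> 1"
        using card_A \<open>a \<in> A\<close> by (simp add: B_def)
      then have "B \<noteq> {}"
        by auto
      have "\<not> one_saturating B"
        using min \<open>a \<in> A\<close> by (auto simp: minimal_one_saturating_def B_def)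
      then obtain g where g: "\<And>x y. x \<in> insert 0 B \<Longrightarrow> y \<in> insert 0 B \<Longrightarrow> g \<noteq> x + y"
        using one_saturating_iff[OF \<open>B \<noteq> {}\<close>] \<open>0 \<notin> A\<close> by (metis B_def DiffD1)
      have "insert 0 B = X - {a}"
        using that by (auto simp: X_def B_def)
      then have g': "x = a \<or> y = a" if "x \<in> X" "y \<in> X" "x + y = g" for x y
        using g[of x y] that by auto
      obtain x y where "x \<in> X" "y \<in> X" "g = x + y"
        using X_cover by blast
      then obtain b where b: "b \<in> X" "g = a + b"
        using g'[of x y] by (metis add.commute)
      have "g \<noteq> 0"
        using g[of 0 0] by simp
      then have "a \<noteq> b"
        using b by simp
      have "a + b \<in> unique_sums X"
      proof (rule unique_sumsI)
        fix u v
        assume uv: "u \<in> X" "v \<in> X" "u + v = a + b"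
        then have "u = a \<or> v = a"
          using g' b by blast
        then show "u \<in> {a, b}"
          using uv(3) by (metis add.commute add_left_cancel insertCI)
      qed (use that b \<open>a \<noteq> b\<close> in auto)
      moreover have "a \<in> ends X (a + b)"
        using that b by (simp add: ends_def ac_simps)
      ultimately show ?thesis
        by blast
    qed
    from spanning_star[OF large this] obtain s where s: "s \<in> X"
      and star: "\<And>x. x \<in> X \<Longrightarrow> x \<noteq> 0 \<Longrightarrow> x \<noteq> s \<Longrightarrow> x + s \<in> unique_sums X"
      by blast
    \<comment> \<open>This is the star property at s in the form used below. The star itself says
      nothing about x = 0; there, u + v = s with u, v different from s would give v + 0 = u + s, a
      second representation of the sum on the edge {u, s}.\<close>
    have unique: "u = s \<or> v = s"
      if "u \<in> X" "v \<in> X" "x \<in> X" "x \<noteq> s" "u + v = x + s" for u v x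
    proof (cases "x = 0")
      case False
      then have "{u, v} = {x, s}"
        using unique_sum_representation[of "x + s" X x s u v] star s that by blast
      then show ?thesis
        by (metis insertCI insertE singletonD)
    next
      case True
      show ?thesis
      proof (rule ccontr)
        assume neq: "\<not> (u = s \<or> v = s)"
        have "u + v = s"
          using that True by simp
        have "u \<noteq> 0" "v \<noteq> 0"
          using neq \<open>u + v = s\<close> by auto
        have "v + 0 = u + s"
          unfolding \<open>u + v = s\<close>[symmetric] by simp
        then have "{v, 0} = {u, s}"
          using unique_sum_representation[of "u + s" X u s v 0] star[OF that(1)] s that neq \<open>u \<noteq> 0\<close>
          by (auto simp: X_def)
        then show False
          using neq that(4) True \<open>u \<noteq> 0\<close> by auto
      qed
    qed
    define S where "S = {x. x \<noteq> 0 \<and> s + x \<in> X}"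
    have "sum_free S"
    proof (rule sum_freeI)
      fix x y
      assume xy: "x \<in> S" "y \<in> S"
      show "x + y \<notin> S"
      proof
        assume "x + y \<in> S"
        moreover have "(s + x) + (s + y) = (s + (x + y)) + s"
          by (simp add: ac_simps)
        moreover have "s + x = s + 0 \<longleftrightarrow> x = 0" for x
          by (rule add_left_cancel)
        ultimately show False
          using unique[of "s + x" "s + y" "s + (x + y)"] xy by (auto simp: S_def)
      qed
    qed
    \<comment> \<open>Any t outside S is a sum x + y in X, hence (s + x) + (s + y). Neither term is
      0, since otherwise s + t would be in X; so both terms lie in S, and T is not sum-free.\<close>
    moreover have "\<not> sum_free T" if ST: "S \<subset> T" for T
    proof
      assume T: "sum_free T"
      obtain t where t: "t \<in> T" "t \<notin> S"
        using ST by blast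
      have "t \<noteq> 0"
        using t sum_free_0[OF T] by auto
      obtain x y where xy: "x \<in> X" "y \<in> X" "t = x + y"
        using X_cover by blast
      have t_eq: "t = (s + x) + (s + y)"
        using xy by (simp add: ac_simps)
      have "s + t \<notin> X"
        using t \<open>t \<noteq> 0\<close> by (simp add: S_def)
      then have "s \<noteq> x" "s \<noteq> y"
        using xy by (metis add.commute bit_vec_add_left_cancel)+
      then have "s + x \<in> S" "s + y \<in> S"
        using xy by (simp_all add: S_def)
      then have "s + x \<in> T" "s + y \<in> T"
        using ST by blast+
      then show False
        using sum_freeD[OF T] t t_eq by blast
    qed
    ultimately have "maximal_sum_free S"
      by (simp add: maximal_sum_free_def)
    moreover have "s \<in> S \<union> {0}"
      using s by (auto simp: S_def X_def)
    moreover have "A = (s +o (S \<union> {0})) - {0}"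
    proof -
      have "x \<in> (+) s ` insert 0 S \<longleftrightarrow> x \<in> X" for x
        using s by (auto simp: mem_translate_iff S_def)
      then show ?thesis
        unfolding translate using \<open>0 \<notin> A\<close> by (auto simp: X_def)
    qed
    ultimately show "\<exists>S s. maximal_sum_free S \<and> s \<in> S \<union> {0} \<and> A = (s +o (S \<union> {0})) - {0}"
      by blast
  next
    assume "\<exists>S s. maximal_sum_free S \<and> s \<in> S \<union> {0} \<and> A = (s +o (S \<union> {0})) - {0}"
    then obtain S s where S: "maximal_sum_free S" "s \<in> insert 0 S" "A = (+) s ` insert 0 S - {0}"
      unfolding translate by auto
    have "0 \<in> (+) s ` insert 0 S"
      using S(2) by (simp only: mem_translate_iff add.right_neutral)
    then have "insert 0 A = (+) s ` insert 0 S"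
      using S(3) by blast
    then show "minimal_one_saturating A"
      using minimal_one_saturating_translate[OF S(1,2) \<open>A \<noteq> {}\<close>] \<open>0 \<notin> A\<close> by simp
  qed
qed

end
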